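(* Let $f_+,f_-,h_+,h_-$ be real $5\times5$ matrices satisfying $$h_+^tf_-+f_+^th_-=0,\qquad h_+^tf_++f_+^th_+=\mathbf 1,\qquad h_-^tf_-+f_-^th_-=-\mathbf 1 .$$ Define $\mathcal N_-=h_+f_+^{-1}$ and $\mathcal N_+=h_-f_-^{-1}$. For $g=(g^\Lambda),e=(e_\Lambda)\in\mathbb R^5$ define $$Z_{+I}=h_{\Lambda I+}\,g^\Lambda+f^\Lambda_{I+}\,e_\Lambda,\qquad Z_{-\dot I}=h_{\Lambda\dot I-}\,g^\Lambda+f^\Lambda_{\dot I-}\,e_\Lambda\qquad(I,\dot I=1,\dots,5).$$ Then $$\sum_IZ_{+I}Z_{+I}+\sum_{\dot I}Z_{-\dot I}Z_{-\dot I}=(g,e)\,\mathcal M(\mathcal N_+,\mathcal N_-)\begin{pmatrix} g \\ e \end{pmatrix},$$ where $$\mathcal M(\mathcal N_+,\mathcal N_-)=\begin{pmatrix}2(\mathcal N_-^{-1}-\mathcal N_+^{-1})^{-1}&(\mathcal N_-+\mathcal N_+)(\mathcal N_--\mathcal N_+)^{-1} \\ -(\mathcal N_--\mathcal N_+)^{-1}(\mathcal N_-+\mathcal N_+)&2(\mathcal N_--\mathcal N_+)^{-1}\end{pmatrix},$$ and $$\sum_IZ_{+I}Z_{+I}-\sum_{\dot I}Z_{-\dot I}Z_{-\dot I}=2\,g^\Lambda e_\Lambda .$$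
   Context: The rows of $f_\pm=(f^\Lambda_{I+})$, $(f^\Lambda_{\dot I-})$ and $h_\pm=(h_{\Lambda I+})$, $(h_{\Lambda\dot I-})$ are labelled by $\Lambda=1,\dots,5$, and the columns by $I$ (for $+$) or $\dot I$ (for $-$), each running over $1,\dots,5$. Repeated indices $\Lambda$ are summed. The stated relations express the $O(5,5)$ property, with respect to the off-diagonal metric $\begin{pmatrix}0&\mathbf 1 \\ \mathbf 1&0\end{pmatrix}$, of the coset representative of $O(5,5)/(O(5)\times O(5))$ built from $f_\pm,h_\pm$ in $D=6$, $N=(4,4)$ supergravity. They imply that $f_\pm$, $h_\pm$, $\mathcal N_\pm$, $\mathcal N_--\mathcal N_+$ and $\mathcal N_-^{-1}-\mathcal N_+^{-1}$ are invertible and that $\mathcal N_\pm=-(\mathcal N_\mp)^t$. *)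

theory Defs
  imports "HOL-Analysis.Analysis"
begin

text \<open>The rows of \<open>f\<close> and \<open>h\<close> carry the index \<open>\<Lambda>\<close> and the columns carry \<open>I\<close> (or the dotted
  index), so \<open>f $ \<Lambda> $ I\<close> stands for \<open>f\<^sup>\<Lambda>\<^sub>I\<close>.\<close>

definition central_charge ::
  "real^'n^'n \<Rightarrow> real^'n^'n \<Rightarrow> real^'n \<Rightarrow> real^'n \<Rightarrow> real^'n" where
  "central_charge h f g e =
     (\<chi> I. (\<Sum>\<Lambda>\<in>UNIV. h $ \<Lambda> $ I * g $ \<Lambda>) + (\<Sum>\<Lambda>\<in>UNIV. f $ \<Lambda> $ I * e $ \<Lambda>))"

definition kinetic_matrix :: "real^'n^'n \<Rightarrow> real^'n^'n \<Rightarrow> real^'n^'n" where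
  "kinetic_matrix h f = h ** matrix_inv f"

definition join_vec :: "'a^'m \<Rightarrow> 'a^'n \<Rightarrow> 'a^('m + 'n)" where
  "join_vec x y = (\<chi> i. case i of Inl j \<Rightarrow> x $ j | Inr j \<Rightarrow> y $ j)"

definition block_mat ::
  "'a^'m^'k \<Rightarrow> 'a^'n^'k \<Rightarrow> 'a^'m^'l \<Rightarrow> 'a^'n^'l \<Rightarrow> 'a^('m + 'n)^('k + 'l)" where
  "block_mat A B C D =
     (\<chi> i. case i of Inl k \<Rightarrow> join_vec (A $ k) (B $ k) | Inr l \<Rightarrow> join_vec (C $ l) (D $ l))"

definition charge_matrix :: "real^'n^'n \<Rightarrow> real^'n^'n \<Rightarrow> real^('n + 'n)^('n + 'n)" where
  "charge_matrix Np Nm =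
     block_mat
       (2 *\<^sub>R matrix_inv (matrix_inv Nm - matrix_inv Np))
       ((Nm + Np) ** matrix_inv (Nm - Np))
       (- (matrix_inv (Nm - Np) ** (Nm + Np)))
       (2 *\<^sub>R matrix_inv (Nm - Np))"

text \<open>\<^const>\<open>matrix_inv\<close> is total, with an unspecified value on singular matrices. The lemma
  \<open>all_inverses_exist\<close> shows that every inverse occurring in \<open>kinetic_matrix\<close> and \<open>charge_matrix\<close>
  is a genuine one under the orthogonality relations.\<close>

lemma invertible_if_pairing_definite:
  fixes A B :: "real^'n^'n"
  assumes eq: "transpose A ** B + transpose B ** A = c *\<^sub>R mat 1" and c: "c \<noteq> 0"
  shows "invertible A"
proof -
  have "v = 0" if v: "A *v v = 0" for v
  proof -
    have "c * (v \<bullet> v) = v \<bullet> ((c *\<^sub>R mat 1) *v v)"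
      by (simp add: scaleR_matrix_vector_assoc [symmetric])
    also have "\<dots> = v \<bullet> (transpose A *v (B *v v)) + v \<bullet> (transpose B *v (A *v v))"
      by (simp add: eq [symmetric] matrix_vector_mult_add_rdistrib matrix_vector_mul_assoc
          inner_add_right)
    also have "\<dots> = 0"
      using v by (simp add: dot_lmul_matrix inner_commute [of v])
    finally show ?thesis using c by simp
  qed
  then show ?thesis
    by (simp add: invertible_left_inverse matrix_left_invertible_ker)
qed

lemma mat_mult_distrib:
  fixes A B C :: "real^'n^'n"
  shows "(A + B) ** C = A ** C + B ** C" "(A - B) ** C = A ** C - B ** C"
    "C ** (A - B) = C ** A - C ** B" "(- A) ** C = - (A ** C)"
    "C ** (- A) = - (C ** A)"
  by (simp_all add: matrix_matrix_mult_def vec_eq_iff algebra_simps sum.distrib sum_subtractf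
      sum_negf)

lemma matrix_inv_mult:
  fixes A :: "real^'n^'n"
  assumes "invertible A"
  shows "A ** matrix_inv A = mat 1" "matrix_inv A ** A = mat 1" "invertible (matrix_inv A)"
  using someI_ex [OF assms [unfolded invertible_def]]
  by (auto simp: matrix_inv_def invertible_def)

lemma all_inverses_exist:
  fixes fp fm hp hm :: "real^'n^'n"
  assumes pm: "transpose hp ** fm + transpose fp ** hm = 0"
    and pp: "transpose hp ** fp + transpose fp ** hp = mat 1"
    and mm: "transpose hm ** fm + transpose fm ** hm = - mat 1"
  defines "Nm \<equiv> kinetic_matrix hp fp" and "Np \<equiv> kinetic_matrix hm fm"
  shows "invertible fp" "invertible fm" "invertible Nm" "invertible Np"
    "invertible (Nm - Np)" "invertible (matrix_inv Nm - matrix_inv Np)"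
proof -
  show fp: "invertible fp"
    by (rule invertible_if_pairing_definite [of _ hp 1]) (use pp in \<open>simp_all add: add.commute\<close>)
  have hp: "invertible hp"
    by (rule invertible_if_pairing_definite [of _ fp 1]) (use pp in simp_all)
  show fm: "invertible fm"
    by (rule invertible_if_pairing_definite [of _ hm "-1"]) (use mm in \<open>simp_all add: add.commute\<close>)
  have hm: "invertible hm"
    by (rule invertible_if_pairing_definite [of _ fm "-1"]) (use mm in simp_all)
  note ifp = matrix_inv_mult [OF fp] and ifm = matrix_inv_mult [OF fm]
  show Nm: "invertible Nm"
    unfolding Nm_def kinetic_matrix_def by (intro invertible_mult hp ifp)
  show Np: "invertible Np"
    unfolding Np_def kinetic_matrix_def by (intro invertible_mult hm ifm)
  have h: "hp = Nm ** fp" "hm = Np ** fm"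
    by (simp_all add: Nm_def Np_def kinetic_matrix_def matrix_mul_assoc [symmetric] ifp ifm)
  let ?S = "transpose Nm + Np" and ?T = "transpose fp"
  note iT = matrix_inv_mult [OF transpose_invertible [OF fp]]
  have S: "?T ** ?S ** fm = 0"
    using pm by (simp add: h matrix_transpose_mul matrix_mul_assoc mat_mult_distrib
        matrix_add_ldistrib)
  have "?S = (matrix_inv ?T ** ?T) ** ?S ** (fm ** matrix_inv fm)"
    by (simp add: ifm iT)
  also have "\<dots> = matrix_inv ?T ** (?T ** ?S ** fm) ** matrix_inv fm"
    by (simp only: matrix_mul_assoc)
  also have "\<dots> = 0"
    unfolding S by (simp add: matrix_matrix_mult_def vec_eq_iff)
  finally have "?S = 0" .
  then have tNm: "transpose Nm = - Np"
    by (simp add: add_eq_0_iff2)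
  have "transpose fp ** ((Nm - Np) ** fp) = mat 1"
    using pp tNm by (simp add: h matrix_transpose_mul matrix_mul_assoc [symmetric]
        mat_mult_distrib)
  then have "invertible ((Nm - Np) ** fp)"
    by (auto simp: invertible_left_inverse invertible_right_inverse)
  then have "invertible (((Nm - Np) ** fp) ** matrix_inv fp)"
    using ifp(3) by (rule invertible_mult)
  then show D: "invertible (Nm - Np)"
    by (simp add: matrix_mul_assoc [symmetric] ifp)
  note iNm = matrix_inv_mult [OF Nm] and iNp = matrix_inv_mult [OF Np]
  have "matrix_inv Nm ** ((Np - Nm) ** matrix_inv Np) = matrix_inv Nm - matrix_inv Np"
    by (simp add: mat_mult_distrib iNp) (simp add: matrix_mul_assoc iNm)
  moreover have "invertible (Np - Nm)"
  proof -
    have "(Np - Nm) ** (- matrix_inv (Nm - Np)) = mat 1"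
      using matrix_inv_mult(1) [OF D]
      by (simp add: matrix_matrix_mult_def vec_eq_iff algebra_simps sum_negf)
    then show ?thesis by (auto simp: invertible_right_inverse)
  qed
  ultimately show "invertible (matrix_inv Nm - matrix_inv Np)"
    by (metis invertible_mult iNm(3) iNp(3))
qed

end

theory Submission
  imports Defs
begin

text \<open>With \<open>D = \<N>\<^sub>- - \<N>\<^sub>+\<close>, the orthogonality relations say \<open>\<N>\<^sub>-\<^sup>t = -\<N>\<^sub>+\<close> and
  \<open>f\<^sub>+ f\<^sub>+\<^sup>t = f\<^sub>- f\<^sub>-\<^sup>t = D\<^sup>-\<^sup>1\<close>. Since \<open>Z\<^sub>+ = f\<^sub>+\<^sup>t (e - \<N>\<^sub>+ g)\<close> and
  \<open>Z\<^sub>- = f\<^sub>-\<^sup>t (e - \<N>\<^sub>- g)\<close>, the squared lengths of both charges are values of the symmetric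
  form \<open>D\<^sup>-\<^sup>1\<close>. The vectors \<open>\<N>\<^sub>\<plusminus> g\<close> have the same length for this form, because
  \<open>D\<^sup>-\<^sup>1 (\<N>\<^sub>- g - \<N>\<^sub>+ g) = g\<close> and \<open>\<N>\<^sub>- + \<N>\<^sub>+\<close> is antisymmetric.\<close>

lemma matrix_inv_eqI:
  fixes A B :: "real^'n^'n"
  assumes "A ** B = mat 1"
  shows "matrix_inv A = B"
proof -
  have "invertible A"
    using assms by (auto simp: invertible_right_inverse)
  then have "matrix_inv A ** (A ** B) = B"
    by (simp add: matrix_mul_assoc matrix_inv_mult)
  then show ?thesis
    by (simp add: assms)
qed

text \<open>For square matrices the left inverse \<open>transpose A ** X\<close> of \<open>A\<close>
  is also a right inverse. Applied with \<open>A\<close> equal to \<open>fp\<close> and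
  \<open>fm\<close>, this puts both charges on the same quadratic form.\<close>

lemma congruent_to_identity_imp_matrix_inv:
  fixes A X :: "real^'n^'n"
  assumes "transpose A ** X ** A = mat 1"
  shows "matrix_inv X = A ** transpose A"
proof (rule matrix_inv_eqI)
  have "(A ** transpose A) ** X = mat 1"
    using assms matrix_left_right_inverse [of "transpose A ** X" A]
    by (simp add: matrix_mul_assoc)
  then show "X ** (A ** transpose A) = mat 1"
    by (simp add: matrix_left_right_inverse)
qed

lemma inner_matrix_vector_mult:
  fixes A :: "real^'n^'m"
  shows "x \<bullet> (A *v y) = (transpose A *v x) \<bullet> y"
  by (simp add: dot_lmul_matrix)

lemma inner_mult_transpose:
  fixes A :: "real^'n^'m"
  shows "(transpose A *v x) \<bullet> (transpose A *v y) = x \<bullet> ((A ** transpose A) *v y)"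
  by (simp only: inner_matrix_vector_mult matrix_vector_mul_assoc [symmetric])

lemma uminus_matrix_vector_mult:
  fixes A :: "real^'n^'m"
  shows "(- A) *v x = - (A *v x)"
  using matrix_vector_mult_diff_rdistrib [of 0 A x] by simp

lemma transpose_uminus:
  fixes A :: "real^'n^'m"
  shows "transpose (- A) = - transpose A"
  by (simp add: transpose_def vec_eq_iff)

lemma kinetic_matrix_mult:
  fixes h f :: "real^'n^'n"
  assumes "invertible f"
  shows "kinetic_matrix h f ** f = h"
  by (simp add: kinetic_matrix_def matrix_mul_assoc [symmetric] matrix_inv_mult [OF assms])

text \<open>Substituting h = N f in the mixed relation leaves
  \<open>transpose fp ** ?S ** fm = 0\<close>, and the invertible outer factors cancel.\<close>

lemma transpose_kinetic_matrix:
  fixes fp fm hp hm :: "real^'n^'n"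
  assumes pm: "transpose hp ** fm + transpose fp ** hm = 0"
    and fp: "invertible fp" and fm: "invertible fm"
  shows "transpose (kinetic_matrix hp fp) = - kinetic_matrix hm fm"
proof -
  let ?S = "transpose (kinetic_matrix hp fp) + kinetic_matrix hm fm"
  let ?T = "transpose fp"
  note iT = matrix_inv_mult [OF transpose_invertible [OF fp]]
  have "?T ** ?S ** fm = transpose (kinetic_matrix hp fp ** fp) ** fm
      + ?T ** (kinetic_matrix hm fm ** fm)"
    by (simp only: matrix_transpose_mul matrix_mul_assoc mat_mult_distrib(1)
        matrix_add_ldistrib)
  then have S: "?T ** ?S ** fm = 0"
    by (simp only: kinetic_matrix_mult fp fm pm)
  have "?S = (matrix_inv ?T ** ?T) ** ?S ** (fm ** matrix_inv fm)"
    by (simp add: iT matrix_inv_mult [OF fm])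
  also have "\<dots> = matrix_inv ?T ** (?T ** ?S ** fm) ** matrix_inv fm"
    by (simp only: matrix_mul_assoc)
  also have "\<dots> = 0"
    unfolding S by (simp add: matrix_matrix_mult_def vec_eq_iff)
  finally show ?thesis
    by (simp add: add_eq_0_iff2)
qed

lemma central_charge_eq:
  "central_charge h f g e = transpose h *v g + transpose f *v e"
  by (simp add: central_charge_def matrix_vector_mult_def transpose_def vec_eq_iff)

text \<open>Pulling out \<open>transpose f\<close> makes the squared length of the charge a value of
  the form \<open>f ** transpose f\<close>.\<close>

lemma central_charge_kinetic_matrix:
  fixes h f :: "real^'n^'n"
  assumes "invertible f"
  shows "central_charge h f g e = transpose f *v (transpose (kinetic_matrix h f) *v g + e)"
proof -
  have "transpose h = transpose f ** transpose (kinetic_matrix h f)"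
    by (metis kinetic_matrix_mult [OF assms] matrix_transpose_mul)
  then show ?thesis
    by (simp only: central_charge_eq matrix_vector_right_distrib matrix_vector_mul_assoc)
qed

lemma sum_UNIV_sum:
  fixes F :: "'a::finite + 'b::finite \<Rightarrow> 'c::comm_monoid_add"
  shows "(\<Sum>i\<in>UNIV. F i) = (\<Sum>j\<in>UNIV. F (Inl j)) + (\<Sum>j\<in>UNIV. F (Inr j))"
  unfolding UNIV_Plus_UNIV [symmetric] by (subst sum.Plus) simp_all

lemma inner_join_vec:
  fixes x x' :: "real^'m" and y y' :: "real^'n"
  shows "join_vec x y \<bullet> join_vec x' y' = x \<bullet> x' + y \<bullet> y'"
  by (simp add: inner_vec_def join_vec_def sum_UNIV_sum)

lemma block_mat_mult_join_vec:
  fixes A :: "real^'m^'k" and B :: "real^'n^'k" and C :: "real^'m^'l" and D :: "real^'n^'l"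
  shows "block_mat A B C D *v join_vec x y = join_vec (A *v x + B *v y) (C *v x + D *v y)"
  by (auto simp: vec_eq_iff matrix_vector_mult_def block_mat_def join_vec_def sum_UNIV_sum
      split: sum.split)

text \<open>The resolvent identity factors the difference of inverses as minus
  \<open>matrix_inv A ** (A - B) ** matrix_inv B\<close>; each factor is then inverted in reverse
  order. This rewrites the upper left block of \<open>charge_matrix\<close> through the inverse of
  \<open>Nm - Np\<close>.\<close>

lemma matrix_inv_diff_matrix_inv:
  fixes A B :: "real^'n^'n"
  assumes A: "invertible A" and B: "invertible B" and AB: "invertible (A - B)"
  shows "matrix_inv (matrix_inv A - matrix_inv B) = - (B ** matrix_inv (A - B) ** A)"
proof (rule matrix_inv_eqI)
  note iA = matrix_inv_mult [OF A] and iB = matrix_inv_mult [OF B]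
    and iAB = matrix_inv_mult [OF AB]
  have "matrix_inv A ** ((A - B) ** matrix_inv B) = matrix_inv B - matrix_inv A"
    by (simp add: mat_mult_distrib iB) (simp add: matrix_mul_assoc iA)
  then have "matrix_inv A - matrix_inv B = - (matrix_inv A ** ((A - B) ** matrix_inv B))"
    by simp
  moreover have "matrix_inv A ** ((A - B) ** matrix_inv B) ** (B ** matrix_inv (A - B) ** A) =
      matrix_inv A ** ((A - B) ** (matrix_inv B ** B) ** matrix_inv (A - B)) ** A"
    by (simp only: matrix_mul_assoc)
  ultimately show "(matrix_inv A - matrix_inv B) ** - (B ** matrix_inv (A - B) ** A) = mat 1"
    by (simp add: mat_mult_distrib(4,5) iA iB iAB)
qed

lemma central_charge_sum_rules:
  fixes fp fm hp hm :: "real^'n^'n" and g e :: "real^'n"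
  assumes pm: "transpose hp ** fm + transpose fp ** hm = 0"
    and pp: "transpose hp ** fp + transpose fp ** hp = mat 1"
    and mm: "transpose hm ** fm + transpose fm ** hm = - mat 1"
  defines "Nm \<equiv> kinetic_matrix hp fp" and "Np \<equiv> kinetic_matrix hm fm"
    and "Zp \<equiv> central_charge hp fp g e" and "Zm \<equiv> central_charge hm fm g e"
  shows "Zp \<bullet> Zp + Zm \<bullet> Zm = join_vec g e \<bullet> (charge_matrix Np Nm *v join_vec g e)"
    and "Zp \<bullet> Zp - Zm \<bullet> Zm = 2 * (g \<bullet> e)"
proof -
  note inv = all_inverses_exist [OF pm pp mm, folded Nm_def Np_def]
  define K where "K = matrix_inv (Nm - Np)"
  have KD: "K ** (Nm - Np) = mat 1"
    unfolding K_def using inv(5) by (rule matrix_inv_mult)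
  have h: "hp = Nm ** fp" "hm = Np ** fm"
    by (simp_all add: Nm_def Np_def kinetic_matrix_mult inv)
  have tm: "transpose Nm = - Np"
    unfolding Nm_def Np_def by (rule transpose_kinetic_matrix [OF pm inv(1,2)])
  have tp: "transpose Np = - Nm"
    by (metis tm minus_minus transpose_transpose transpose_uminus)
  have "transpose fp ** (Nm - Np) ** fp = mat 1"
    using pp by (simp add: h matrix_transpose_mul tm mat_mult_distrib
        matrix_mul_assoc matrix_add_ldistrib)
  then have Kp: "K = fp ** transpose fp"
    unfolding K_def by (rule congruent_to_identity_imp_matrix_inv)
  \<comment> \<open>Here \<open>transpose Np = - Nm\<close> produces \<open>Np - Nm\<close>, so the
    sign matches the - 1 of the relation and the same \<open>K\<close> results.\<close>
  have "- (transpose fm ** (Nm - Np) ** fm) = - mat 1"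
    using mm by (simp add: h matrix_transpose_mul tp mat_mult_distrib
        matrix_mul_assoc matrix_add_ldistrib)
  then have Km: "K = fm ** transpose fm"
    unfolding K_def by (intro congruent_to_identity_imp_matrix_inv) simp
  have "transpose K = K"
    by (simp add: Kp matrix_transpose_mul)
  then have K_sym: "x \<bullet> (K *v y) = y \<bullet> (K *v x)" for x y
    by (metis inner_matrix_vector_mult inner_commute)
  \<comment> \<open>Transposition exchanges the two kinetic matrices up to sign: \<open>Zp\<close>,
    built with \<open>Nm\<close>, involves \<open>a\<close>, and \<open>Zm\<close> involves
    \<open>b\<close>.\<close>
  define a b where "a = Np *v g" and "b = Nm *v g"
  have Zp: "Zp \<bullet> Zp = (e - a) \<bullet> (K *v (e - a))"
    unfolding Zp_def central_charge_kinetic_matrix [OF inv(1)] Nm_def [symmetric] tm Kp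
    by (simp only: uminus_matrix_vector_mult a_def inner_mult_transpose uminus_add_conv_diff)
  have Zm: "Zm \<bullet> Zm = (e - b) \<bullet> (K *v (e - b))"
    unfolding Zm_def central_charge_kinetic_matrix [OF inv(2)] Np_def [symmetric] tp Km
    by (simp only: uminus_matrix_vector_mult b_def inner_mult_transpose uminus_add_conv_diff)
  have "K *v (b - a) = g"
    by (simp add: a_def b_def matrix_vector_mult_diff_rdistrib [symmetric]
        matrix_vector_mul_assoc KD)
  then have Kb: "K *v b = K *v a + g"
    by (simp add: matrix_vector_mult_diff_distrib algebra_simps)
  have g_Np: "g \<bullet> (Np *v x) = - (b \<bullet> x)" for x
    by (simp only: inner_matrix_vector_mult tp uminus_matrix_vector_mult b_def inner_minus_left)
  have gab: "g \<bullet> a = - (g \<bullet> b)"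
    by (simp only: a_def g_Np inner_commute)
  \<comment> \<open>Trading \<open>b\<close> for \<open>a\<close> in one slot at a time costs
    \<open>g \<bullet> b\<close> and then \<open>g \<bullet> a\<close>, which cancel by
    \<open>gab\<close>.\<close>
  have "b \<bullet> (K *v b) = b \<bullet> (K *v a) + g \<bullet> b"
    by (simp add: Kb inner_add_right inner_commute)
  moreover have "b \<bullet> (K *v a) = a \<bullet> (K *v a) + g \<bullet> a"
    by (simp add: K_sym [of b] Kb inner_add_right inner_commute)
  ultimately have ab: "a \<bullet> (K *v a) = b \<bullet> (K *v b)"
    using gab by simp
  have exp: "(e - x) \<bullet> (K *v (e - x)) = e \<bullet> (K *v e) - 2 * (e \<bullet> (K *v x)) + x \<bullet> (K *v x)" for x
    using K_sym [of x e] by (simp add: matrix_vector_mult_diff_distrib inner_diff)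
  \<comment> \<open>Only the cross terms survive, and \<open>K *v b - K *v a = g\<close>.\<close>
  show "Zp \<bullet> Zp - Zm \<bullet> Zm = 2 * (g \<bullet> e)"
    by (simp add: Zp Zm exp ab Kb inner_add_right inner_commute)
  \<comment> \<open>The upper left block is -2 N_+ K N_-; moving N_+ onto \<open>g\<close> gives the
    term in \<open>b\<close> alone. The off-diagonal blocks give the cross terms.\<close>
  have "join_vec g e \<bullet> (charge_matrix Np Nm *v join_vec g e) =
      2 * (b \<bullet> (K *v b)) - b \<bullet> (K *v e) - a \<bullet> (K *v e) - e \<bullet> (K *v (a + b))
        + 2 * (e \<bullet> (K *v e))" (is "?L = ?R")
  proof -
    have NpK: "(Nm + Np) *v x = Nm *v x + Np *v x" for x
      by (rule matrix_vector_mult_add_rdistrib)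
    have g_Nm: "g \<bullet> (Nm *v x) = - (a \<bullet> x)" for x
      by (simp only: inner_matrix_vector_mult tm uminus_matrix_vector_mult a_def inner_minus_left)
    have "?L = g \<bullet> (2 *\<^sub>R - (Np *v (K *v b))) + g \<bullet> ((Nm + Np) *v (K *v e))
        + (e \<bullet> (- (K *v ((Nm + Np) *v g))) + e \<bullet> (2 *\<^sub>R (K *v e)))"
      by (simp only: charge_matrix_def block_mat_mult_join_vec inner_join_vec
          matrix_inv_diff_matrix_inv [OF inv(3-5)] K_def [symmetric] b_def
          scaleR_matrix_vector_assoc [symmetric] uminus_matrix_vector_mult
          matrix_vector_mul_assoc [symmetric] inner_add_right)
    also have "\<dots> = ?R"
      by (simp add: NpK inner_add_right g_Np g_Nm a_def [symmetric] b_def [symmetric] add.commute)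
    finally show ?thesis .
  qed
  \<comment> \<open>Symmetry of \<open>K\<close> merges the cross terms, and \<open>ab\<close>
    supplies the factor 2 on the square of \<open>b\<close>.\<close>
  then show "Zp \<bullet> Zp + Zm \<bullet> Zm = join_vec g e \<bullet> (charge_matrix Np Nm *v join_vec g e)"
    using K_sym [of a e] K_sym [of b e]
    by (simp add: Zp Zm exp ab matrix_vector_right_distrib inner_add_right)
qed

theorem mainTheorem4:
  fixes fp fm hp hm :: "real^5^5" and Nm Np :: "real^5^5"
    and g e :: "real^5" and Zp Zm :: "real^5"
  assumes "transpose hp ** fm + transpose fp ** hm = 0"
    and "transpose hp ** fp + transpose fp ** hp = mat 1"
    and "transpose hm ** fm + transpose fm ** hm = - mat 1"
    and "Nm = kinetic_matrix hp fp"
    and "Np = kinetic_matrix hm fm"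
    and "Zp = central_charge hp fp g e"
    and "Zm = central_charge hm fm g e"
  shows "(\<Sum>I\<in>UNIV. Zp $ I * Zp $ I) + (\<Sum>I\<in>UNIV. Zm $ I * Zm $ I) =
      join_vec g e \<bullet> (charge_matrix Np Nm *v join_vec g e) \<and>
    (\<Sum>I\<in>UNIV. Zp $ I * Zp $ I) - (\<Sum>I\<in>UNIV. Zm $ I * Zm $ I) =
      2 * (\<Sum>\<Lambda>\<in>UNIV. g $ \<Lambda> * e $ \<Lambda>)"
  using central_charge_sum_rules [OF assms(1-3), of g e] assms(4-7)
  by (simp add: inner_vec_def)

end
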